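(* Let $J\in\mathbb R^{6K\times6}$ be the stacked residual Jacobian of the wrench measurements at the nominal pose $\bar X_B$, let $\Sigma_K=I_K\otimes\Sigma_w$ with $\Sigma_w\in\mathbb R^{6\times6}$, $\Sigma_w\succ0$, and let $$I(\bar X_B)=J^\top\Sigma_K^{-1}J=\begin{bmatrix}I_{\phi\phi}&I_{\phi v}\\ I_{v\phi}&I_{vv}\end{bmatrix}$$ be the local Gauss--Newton information matrix, partitioned into $3\times3$ blocks according to $\xi_B=[\phi^\top,v^\top]^\top$, $\phi,v\in\mathbb R^3$. Assume $I(\bar X_B)\succeq0$ and $I_{vv}\succ0$, and define $$I_{\rm rot}:=I_{\phi\phi}-I_{\phi v}I_{vv}^{-1}I_{v\phi}.$$ Then $I_{\rm rot}\succeq0$, and for every $\phi\in\mathbb R^3$, $$\phi^\top I_{\rm rot}\phi=\min_{v\in\mathbb R^3}\begin{bmatrix}\phi\\ v\end{bmatrix}^{\top}I(\bar X_B)\begin{bmatrix}\phi\\ v\end{bmatrix},$$ and the unique $v$ attaining the minimum is $v^\star(\phi)=-I_{vv}^{-1}I_{v\phi}\phi$. Thus $I_{\rm rot}$ is the effective local Fisher information for rotation after optimal translational compensation. Moreover, the scalar $s_{\rm rot}:=\lambda_{\min}(I_{\rm rot})$ satisfies $$s_{\rm rot}=\min_{\|\phi\|_2=1}\ \min_{v\in\mathbb R^3}\begin{bmatrix}\phi\\ v\end{bmatrix}^{\top}I(\bar X_B)\begin{bmatrix}\phi\\ v\end{bmatrix};$$ equivalently, for every $\phi\in\mathbb R^3$,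 $$\min_{v\in\mathbb R^3}\begin{bmatrix}\phi\\ v\end{bmatrix}^{\top}I(\bar X_B)\begin{bmatrix}\phi\\ v\end{bmatrix}\ge s_{\rm rot}\|\phi\|_2^2.$$ If $\phi_{\min}$ is a unit eigenvector of $I_{\rm rot}$ associated with $\lambda_{\min}(I_{\rm rot})$, then $\phi_{\min}$ is a least-informative rotational direction in the local linearized wrench model (that is, it attains the outer minimum above), and $v^\star(\phi_{\min})$ is the corresponding optimal translational compensator.
   Context: The unknown pose lives in $G=\mathrm{SO}(3)\times\mathbb R^3$, with right perturbations $(R,p)\oplus[\phi^\top,v^\top]^\top=(R\exp(\phi^\wedge),p+v)$, where $\phi^\wedge$ is the skew matrix of $\phi\in\mathbb R^3$ and $v\in\mathbb R^3$. Given $K$ wrench residual maps $r_k:G\to\mathbb R^6$ (measured wrench minus predicted wrench), $J_k:=\partial r_k(\bar X_B\oplus\xi_B)/\partial\xi_B|_{\xi_B=0}\in\mathbb R^{6\times6}$ and $J$ is the vertical stack of $J_1,\dots,J_K$; $\Sigma_w$ is the measurement noise covariance. $\lambda_{\min}$ denotes the smallest eigenvalue of a symmetric matrix. The "effective information" of a rotational direction $\phi$ is the value of the quadratic form of $I(\bar X_B)$ at $[\phi^\top,v^\top]^\top$ minimized over translational perturbations $v$. *)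

theory Defs
  imports "HOL-Analysis.Analysis"
begin

section \<open>Poses and right perturbations\<close>

definition SO3 :: "(real^3^3) set" where
  "SO3 = {R. rotation_matrix R}"

type_synonym pose = "(real^3^3) \<times> (real^3)"

text \<open>The type \<open>pose\<close> is larger than the pose space \<open>G\<close>; only the elements of \<open>pose_space\<close> are poses.\<close>

definition pose_space :: "pose set" where
  "pose_space = SO3 \<times> UNIV"

definition hat :: "real^3 \<Rightarrow> real^3^3" where
  "hat \<phi> = vector [vector [0, - (\<phi>$3), \<phi>$2],
                   vector [\<phi>$3, 0, - (\<phi>$1)],
                   vector [- (\<phi>$2), \<phi>$1, 0]]"

text \<open>The library function \<open>exp\<close> is not available here, since \<open>real^'n^'n\<close> is not an instance
  of the normed-algebra classes.\<close>

definition matrix_power :: "real^'n^'n \<Rightarrow> nat \<Rightarrow> real^'n^'n" where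
  "matrix_power A n = (((**) A) ^^ n) (mat 1)"

definition matrix_exp :: "real^'n^'n \<Rightarrow> real^'n^'n" where
  "matrix_exp A = (\<Sum>n. (1 / fact n) *\<^sub>R matrix_power A n)"

text \<open>A vector of \<open>R\<^sup>6 = R\<^sup>3 \<times> R\<^sup>3\<close> that is partitioned as \<open>[\<phi>; v]\<close> is indexed by the
  sum type \<open>3 + 3\<close>: \<open>Inl\<close> is the rotational part and \<open>Inr\<close> the translational part.\<close>

definition join :: "real^'a \<Rightarrow> real^'b \<Rightarrow> real^('a + 'b)" where
  "join x y = (\<chi> i. case i of Inl a \<Rightarrow> x $ a | Inr b \<Rightarrow> y $ b)"

definition rot_part :: "real^(3 + 3) \<Rightarrow> real^3" where
  "rot_part \<xi> = (\<chi> i. \<xi> $ Inl i)"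

definition trans_part :: "real^(3 + 3) \<Rightarrow> real^3" where
  "trans_part \<xi> = (\<chi> i. \<xi> $ Inr i)"

definition oplus :: "pose \<Rightarrow> real^(3 + 3) \<Rightarrow> pose" where
  "oplus X \<xi> = (fst X ** matrix_exp (hat (rot_part \<xi>)), snd X + trans_part \<xi>)"

section \<open>Stacked Jacobian and Gauss--Newton information\<close>

definition residual_jacobian :: "(pose \<Rightarrow> real^6) \<Rightarrow> pose \<Rightarrow> real^(3 + 3)^6" where
  "residual_jacobian r X = jacobian (\<lambda>\<xi>. r (oplus X \<xi>)) (at 0)"

text \<open>With \<open>K = CARD('k)\<close>, the \<open>6K\<close> rows of the stack are indexed by pairs
  (measurement, wrench component).\<close>

definition stacked_jacobian :: "('k::finite \<Rightarrow> pose \<Rightarrow> real^6) \<Rightarrow> pose \<Rightarrow> real^(3 + 3)^('k \<times> 6)" where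
  "stacked_jacobian r X = (\<chi> ki. residual_jacobian (r (fst ki)) X $ snd ki)"

definition kronecker :: "real^'m^'n \<Rightarrow> real^'p^'q \<Rightarrow> real^('m \<times> 'p)^('n \<times> 'q)" where
  "kronecker A B = (\<chi> i j. A $ fst i $ fst j * B $ snd i $ snd j)"

definition stacked_covariance :: "real^6^6 \<Rightarrow> real^('k::finite \<times> 6)^('k \<times> 6)" where
  "stacked_covariance \<Sigma>w = kronecker (mat 1 :: real^'k^'k) \<Sigma>w"

section \<open>Symmetric matrices\<close>

definition quad_form :: "real^'n^'n \<Rightarrow> real^'n \<Rightarrow> real" where
  "quad_form A x = x \<bullet> (A *v x)"

definition pos_semidef :: "real^'n^'n \<Rightarrow> bool" where
  "pos_semidef A \<longleftrightarrow> transpose A = A \<and> (\<forall>x. 0 \<le> quad_form A x)"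

definition pos_def :: "real^'n^'n \<Rightarrow> bool" where
  "pos_def A \<longleftrightarrow> transpose A = A \<and> (\<forall>x. x \<noteq> 0 \<longrightarrow> 0 < quad_form A x)"

definition eigenvector :: "real^'n^'n \<Rightarrow> real^'n \<Rightarrow> real \<Rightarrow> bool" where
  "eigenvector A x \<mu> \<longleftrightarrow> x \<noteq> 0 \<and> A *v x = \<mu> *\<^sub>R x"

definition eigenvalue :: "real^'n^'n \<Rightarrow> real \<Rightarrow> bool" where
  "eigenvalue A \<mu> \<longleftrightarrow> (\<exists>x. eigenvector A x \<mu>)"

text \<open>Meaningful for symmetric \<open>A\<close>, which has finitely many and at least one real eigenvalue.\<close>

definition lambda_min :: "real^'n^'n \<Rightarrow> real" where
  "lambda_min A = (LEAST \<mu>. eigenvalue A \<mu>)"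

section \<open>Blocks and rotational information\<close>

definition block11 :: "real^('a::finite + 'b::finite)^('a + 'b) \<Rightarrow> real^'a^'a" where
  "block11 M = (\<chi> i j. M $ Inl i $ Inl j)"

definition block12 :: "real^('a::finite + 'b::finite)^('a + 'b) \<Rightarrow> real^'b^'a" where
  "block12 M = (\<chi> i j. M $ Inl i $ Inr j)"

definition block21 :: "real^('a::finite + 'b::finite)^('a + 'b) \<Rightarrow> real^'a^'b" where
  "block21 M = (\<chi> i j. M $ Inr i $ Inl j)"

definition block22 :: "real^('a::finite + 'b::finite)^('a + 'b) \<Rightarrow> real^'b^'b" where
  "block22 M = (\<chi> i j. M $ Inr i $ Inr j)"

definition is_minimum :: "real \<Rightarrow> real set \<Rightarrow> bool" where
  "is_minimum m S \<longleftrightarrow> m \<in> S \<and> (\<forall>s\<in>S. m \<le> s)"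

text \<open>The minimum over \<open>v\<close> of the quadratic form at \<open>[\<phi>; v]\<close>; it is the intended number
  whenever that minimum is attained.\<close>

definition effective_information :: "real^(3 + 3)^(3 + 3) \<Rightarrow> real^3 \<Rightarrow> real" where
  "effective_information I \<phi> = (LEAST m. m \<in> range (\<lambda>v. quad_form I (join \<phi> v)))"

definition optimal_compensator :: "real^(3 + 3)^(3 + 3) \<Rightarrow> real^3 \<Rightarrow> real^3 \<Rightarrow> bool" where
  "optimal_compensator I \<phi> v \<longleftrightarrow> is_arg_min (\<lambda>v. quad_form I (join \<phi> v)) (\<lambda>_. True) v"

definition least_informative_direction :: "real^(3 + 3)^(3 + 3) \<Rightarrow> real^3 \<Rightarrow> bool" where
  "least_informative_direction I \<phi> \<longleftrightarrow>
     is_arg_min (effective_information I) (\<lambda>\<phi>. norm \<phi> = 1) \<phi>"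

end

theory Submission
  imports Defs
begin

text \<open>Completing the square in the translational block gives
  \<open>[\<phi>; v]\<^sup>T I [\<phi>; v] = \<phi>\<^sup>T I\<^sub>r\<^sub>o\<^sub>t \<phi> + (v - v\<^sup>\<star>(\<phi>))\<^sup>T I\<^sub>v\<^sub>v (v - v\<^sup>\<star>(\<phi>))\<close>,
  and positive definiteness of \<open>I\<^sub>v\<^sub>v\<close> makes \<open>v\<^sup>\<star>(\<phi>)\<close> the unique minimizer. The outer minimum is the
  variational characterization of the smallest eigenvalue: the minimum \<open>\<mu>\<close> of the quadratic form of
  a symmetric \<open>A\<close> over the unit sphere is an eigenvalue because the positive semidefinite matrix
  \<open>A - \<mu> 1\<close> annihilates every zero of its own quadratic form.\<close>

lemma symmetric_inner_matrix_vector: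
  fixes A :: "real^'n^'n"
  assumes "transpose A = A"
  shows "x \<bullet> (A *v y) = y \<bullet> (A *v x)"
  by (metis assms dot_lmul_matrix inner_commute transpose_matrix_vector)

lemma is_minimum_Least: "is_minimum m S \<Longrightarrow> (LEAST x. x \<in> S) = m"
  unfolding is_minimum_def by (rule Least_equality) auto

lemma quad_form_add:
  fixes A :: "real^'n^'n"
  assumes "transpose A = A"
  shows "quad_form A (x + y) = quad_form A x + 2 * (y \<bullet> (A *v x)) + quad_form A y"
  using symmetric_inner_matrix_vector[OF assms, of x y]
  by (simp add: quad_form_def matrix_vector_right_distrib inner_add_left inner_add_right)

lemma quad_form_scaleR: "quad_form A (c *\<^sub>R x) = c\<^sup>2 * quad_form A x"
  by (simp add: quad_form_def matrix_vector_mult_scaleR power2_eq_square)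

lemma pos_semidef_quad_form_eq_0:
  fixes A :: "real^'n^'n"
  assumes psd: "pos_semidef A" and zero: "quad_form A x = 0"
  shows "A *v x = 0"
proof -
  define w where "w = A *v x"
  define a c where "a = w \<bullet> w" and "c = quad_form A w"
  have sym: "transpose A = A" and nn: "\<And>y. 0 \<le> quad_form A y"
    using psd by (auto simp: pos_semidef_def)
  have c: "0 \<le> c" using nn by (simp add: c_def)
  define t where "t = - a / (c + 1)"
  have "0 \<le> quad_form A (x + t *\<^sub>R w)" by (rule nn)
  also have "\<dots> = 2 * t * a + t\<^sup>2 * c"
    by (simp add: quad_form_add[OF sym] zero quad_form_scaleR a_def c_def flip: w_def)
  also have "\<dots> = - (a\<^sup>2 * (c + 2) / (c + 1)\<^sup>2)"
  proof -
    have "c + 1 \<noteq> 0" using c by simp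
    then show ?thesis
      by (simp add: t_def divide_simps power2_eq_square) (simp add: algebra_simps)
  qed
  finally have "a\<^sup>2 * (c + 2) / (c + 1)\<^sup>2 \<le> 0" by simp
  with c have "a\<^sup>2 * (c + 2) \<le> 0"
    by (simp add: divide_le_0_iff)
  with c have "a = 0"
    by (simp add: mult_le_0_iff)
  then show ?thesis by (simp add: a_def w_def)
qed

lemma lambda_min_symmetric:
  fixes A :: "real^'n^'n"
  assumes sym: "transpose A = A"
  shows "\<exists>x. norm x = 1 \<and> eigenvector A x (lambda_min A)"
    and "lambda_min A * (norm y)\<^sup>2 \<le> quad_form A y"
proof -
  have "continuous_on (sphere 0 1) (quad_form A)"
    unfolding quad_form_def by (intro continuous_intros)
  moreover have "sphere (0::real^'n) 1 \<noteq> {}" by simp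
  ultimately obtain u where u: "norm u = 1"
    and umin: "\<And>y. norm y = 1 \<Longrightarrow> quad_form A u \<le> quad_form A y"
    using continuous_attains_inf[of "sphere (0::real^'n) 1" "quad_form A"]
    by (auto simp: compact_sphere)
  define m where "m = quad_form A u"
  have bound: "m * (norm y)\<^sup>2 \<le> quad_form A y" for y
  proof (cases "y = 0")
    case False
    have "m \<le> quad_form A (inverse (norm y) *\<^sub>R y)"
      unfolding m_def using False by (intro umin) simp
    with False show ?thesis
      by (simp add: quad_form_scaleR field_simps)
  qed (simp add: quad_form_def)
  define B where "B = A - m *\<^sub>R mat 1"
  have B: "B *v y = A *v y - m *\<^sub>R y" for y
    by (simp add: B_def matrix_vector_mult_diff_rdistrib scaleR_matrix_vector_assoc[symmetric])
  have qB: "quad_form B y = quad_form A y - m * (norm y)\<^sup>2" for y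
    by (simp add: quad_form_def B inner_diff_right power2_norm_eq_inner)
  have "transpose B = B"
    using sym by (simp add: B_def transpose_def mat_def vec_eq_iff)
  then have "pos_semidef B"
    using bound by (simp add: pos_semidef_def qB)
  moreover have "quad_form B u = 0" by (simp add: qB u m_def)
  ultimately have "B *v u = 0" by (rule pos_semidef_quad_form_eq_0)
  then have eig: "eigenvector A u m"
    using u by (auto simp: eigenvector_def B)
  have "lambda_min A = m"
    unfolding lambda_min_def
  proof (rule Least_equality)
    show "eigenvalue A m" using eig by (auto simp: eigenvalue_def)
  next
    fix \<mu> assume "eigenvalue A \<mu>"
    then obtain y where "y \<noteq> 0" and "A *v y = \<mu> *\<^sub>R y"
      by (auto simp: eigenvalue_def eigenvector_def)
    with bound[of y] show "m \<le> \<mu>"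
      by (simp add: quad_form_def power2_norm_eq_inner)
  qed
  with u eig bound show "\<exists>x. norm x = 1 \<and> eigenvector A x (lambda_min A)"
    and "lambda_min A * (norm y)\<^sup>2 \<le> quad_form A y"
    by auto
qed

lemma
  fixes A :: "'a::semiring_1^'n^'m"
  assumes "invertible A"
  shows matrix_inv_right: "A ** matrix_inv A = mat 1"
    and matrix_inv_left: "matrix_inv A ** A = mat 1"
  using someI_ex[OF assms[unfolded invertible_def]] by (simp_all add: matrix_inv_def)

lemma pos_def_invertible:
  fixes A :: "real^'n^'n"
  assumes "pos_def A"
  shows "invertible A"
  using assms unfolding invertible_left_inverse matrix_left_invertible_ker pos_def_def quad_form_def
  by (metis inner_zero_right less_irrefl)

lemma quad_form_join:
  fixes M :: "real^('a::finite + 'b::finite)^('a + 'b)"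
  shows "quad_form M (join x y) =
    x \<bullet> (block11 M *v x) + x \<bullet> (block12 M *v y) + y \<bullet> (block21 M *v x) + y \<bullet> (block22 M *v y)"
  by (simp add: quad_form_def join_def block11_def block12_def block21_def block22_def
      inner_vec_def matrix_vector_mult_def UNIV_Plus_UNIV[symmetric] sum.Plus
      sum.distrib distrib_left del: UNIV_Plus_UNIV)

definition schur_complement :: "real^('a::finite + 'b::finite)^('a + 'b) \<Rightarrow> real^'a^'a" where
  "schur_complement M = block11 M - block12 M ** matrix_inv (block22 M) ** block21 M"

lemma transpose_block:
  fixes M :: "real^('a::finite + 'b::finite)^('a + 'b)"
  assumes "transpose M = M"
  shows "transpose (block11 M) = block11 M" "transpose (block12 M) = block21 M"
    "transpose (block21 M) = block12 M" "transpose (block22 M) = block22 M"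
  using assms
  by (auto simp: transpose_def block11_def block12_def block21_def block22_def vec_eq_iff)

lemma transpose_matrix_inv_symmetric:
  fixes A :: "real^'n^'n"
  assumes "transpose A = A" "invertible A"
  shows "transpose (matrix_inv A) = matrix_inv A"
  by (metis assms matrix_inv_left matrix_inv_right matrix_mul_assoc matrix_mul_lid matrix_mul_rid
      matrix_transpose_mul transpose_mat)

lemma transpose_schur_complement:
  fixes M :: "real^('a::finite + 'b::finite)^('a + 'b)"
  assumes "transpose M = M" "invertible (block22 M)"
  shows "transpose (schur_complement M) = schur_complement M"
proof -
  have "transpose (A - B) = transpose A - transpose B" for A B :: "real^'a^'a"
    by (simp add: transpose_def vec_eq_iff)
  then show ?thesis
    using transpose_block[OF assms(1)] transpose_matrix_inv_symmetric[of "block22 M"] assms(2)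
    by (simp add: schur_complement_def matrix_transpose_mul matrix_mul_assoc)
qed

lemma quad_form_join_schur_complement:
  fixes M :: "real^('a::finite + 'b::finite)^('a + 'b)"
  assumes sym: "transpose M = M" and inv: "invertible (block22 M)"
  shows "quad_form M (join x v) = quad_form (schur_complement M) x
    + quad_form (block22 M) (v + matrix_inv (block22 M) *v (block21 M *v x))"
proof -
  define c w where "c = block21 M *v x" and "w = matrix_inv (block22 M) *v c"
  have Dw: "block22 M *v w = c"
    by (simp add: w_def matrix_vector_mul_assoc matrix_inv_right inv)
  have B: "x \<bullet> (block12 M *v y) = y \<bullet> c" for y
    by (metis c_def dot_lmul_matrix inner_commute sym transpose_block(3) transpose_matrix_vector)
  have "quad_form (schur_complement M) x = x \<bullet> (block11 M *v x) - w \<bullet> c"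
    using B[of w]
    by (simp add: quad_form_def schur_complement_def matrix_vector_mult_diff_rdistrib
        inner_diff_right w_def c_def matrix_vector_mul_assoc matrix_mul_assoc)
  moreover have "quad_form (block22 M) (v + w)
      = quad_form (block22 M) v + 2 * (v \<bullet> c) + w \<bullet> c"
    using quad_form_add[OF transpose_block(4)[OF sym], of w v]
    by (simp add: add.commute Dw quad_form_def)
  moreover have "quad_form M (join x v)
      = x \<bullet> (block11 M *v x) + 2 * (v \<bullet> c) + quad_form (block22 M) v"
    unfolding quad_form_join B by (simp add: quad_form_def c_def)
  ultimately show ?thesis
    by (simp flip: c_def w_def)
qed

theorem theorem3p2:
  fixes r :: "'k::finite \<Rightarrow> pose \<Rightarrow> real^6"
    and X :: pose
    and \<Sigma>w :: "real^6^6"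
    and \<Sigma>K :: "real^('k \<times> 6)^('k \<times> 6)"
    and J :: "real^(3 + 3)^('k \<times> 6)"
    and I :: "real^(3 + 3)^(3 + 3)"
    and I\<phi>\<phi> I\<phi>v Iv\<phi> Ivv Irot :: "real^3^3"
    and vstar :: "real^3 \<Rightarrow> real^3"
    and srot :: real
  assumes "X \<in> pose_space"
    and "\<And>k. (\<lambda>\<xi>. r k (oplus X \<xi>)) differentiable (at 0)"
    and "pos_def \<Sigma>w"
    and "\<Sigma>K = stacked_covariance \<Sigma>w"
    and "J = stacked_jacobian r X"
    and "I = transpose J ** matrix_inv \<Sigma>K ** J"
    and "I\<phi>\<phi> = block11 I" and "I\<phi>v = block12 I" and "Iv\<phi> = block21 I" and "Ivv = block22 I"
    and "pos_semidef I"
    and "pos_def Ivv"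
    and "Irot = I\<phi>\<phi> - I\<phi>v ** matrix_inv Ivv ** Iv\<phi>"
    and "\<And>\<phi>. vstar \<phi> = - (matrix_inv Ivv *v (Iv\<phi> *v \<phi>))"
    and "srot = lambda_min Irot"
  shows "pos_semidef Irot
    \<and> (\<forall>\<phi>. is_minimum (quad_form Irot \<phi>) (range (\<lambda>v. quad_form I (join \<phi> v))))
    \<and> (\<forall>\<phi>. effective_information I \<phi> = quad_form Irot \<phi>)
    \<and> (\<forall>\<phi> v. optimal_compensator I \<phi> v \<longleftrightarrow> v = vstar \<phi>)
    \<and> is_minimum srot (effective_information I ` {\<phi>. norm \<phi> = 1})
    \<and> (\<forall>\<phi>. effective_information I \<phi> \<ge> srot * (norm \<phi>)\<^sup>2)
    \<and> (\<forall>\<phi>min. norm \<phi>min = 1 \<and> eigenvector Irot \<phi>min srot \<longrightarrow>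
          least_informative_direction I \<phi>min
          \<and> effective_information I \<phi>min = srot
          \<and> (\<forall>v. optimal_compensator I \<phi>min v \<longleftrightarrow> v = vstar \<phi>min))"
proof -
  have Irot: "Irot = schur_complement I"
    using assms(7-10,13) by (simp add: schur_complement_def)
  have sym: "transpose I = I" and nn: "\<And>x. 0 \<le> quad_form I x"
    using assms(11) by (auto simp: pos_semidef_def)
  have inv: "invertible (block22 I)"
    using pos_def_invertible assms(10,12) by blast
  have sq: "quad_form I (join \<phi> v) = quad_form Irot \<phi> + quad_form Ivv (v - vstar \<phi>)" for \<phi> v
    using quad_form_join_schur_complement[OF sym inv, of \<phi> v] assms(9,10,14) Irot by simp
  have pd: "0 < quad_form Ivv x" if "x \<noteq> 0" for x
    using assms(12) that by (auto simp: pos_def_def)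
  have zero: "quad_form Ivv 0 = 0" by (simp add: quad_form_def)
  have at_star: "quad_form I (join \<phi> (vstar \<phi>)) = quad_form Irot \<phi>" for \<phi>
    by (simp add: sq zero)
  have lower: "quad_form Irot \<phi> \<le> quad_form I (join \<phi> v)" for \<phi> v
    using pd[of "v - vstar \<phi>"] by (cases "v = vstar \<phi>") (auto simp: sq zero)
  have symrot: "transpose Irot = Irot"
    using transpose_schur_complement[OF sym inv] Irot by simp
  have "pos_semidef Irot"
    unfolding pos_semidef_def using symrot nn at_star by metis
  moreover have inner_min: "is_minimum (quad_form Irot \<phi>) (range (\<lambda>v. quad_form I (join \<phi> v)))" for \<phi>
  proof -
    have "quad_form Irot \<phi> \<in> range (\<lambda>v. quad_form I (join \<phi> v))"
      unfolding at_star[of \<phi>, symmetric] by (rule rangeI)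
    then show ?thesis using lower by (auto simp only: is_minimum_def)
  qed
  moreover have eff: "effective_information I \<phi> = quad_form Irot \<phi>" for \<phi>
    unfolding effective_information_def by (rule is_minimum_Least[OF inner_min])
  moreover have opt: "optimal_compensator I \<phi> v \<longleftrightarrow> v = vstar \<phi>" for \<phi> v
  proof
    assume "optimal_compensator I \<phi> v"
    then have "\<not> quad_form I (join \<phi> (vstar \<phi>)) < quad_form I (join \<phi> v)"
      by (simp add: optimal_compensator_def is_arg_min_def)
    then show "v = vstar \<phi>"
      using pd[of "v - vstar \<phi>"] by (auto simp: sq zero)
  next
    assume "v = vstar \<phi>"
    then show "optimal_compensator I \<phi> v"
      using lower by (auto simp: optimal_compensator_def is_arg_min_def at_star not_less)
  qed
  moreover have bound: "srot * (norm \<phi>)\<^sup>2 \<le> effective_information I \<phi>" for \<phi>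
    using lambda_min_symmetric(2)[OF symrot] by (simp add: eff assms(15))
  have bound1: "srot \<le> effective_information I \<phi>" if "norm \<phi> = 1" for \<phi>
    using bound[of \<phi>] that by simp
  have att: "effective_information I \<phi> = srot"
    if "norm \<phi> = 1" "eigenvector Irot \<phi> srot" for \<phi>
    using that by (simp add: eff quad_form_def eigenvector_def flip: power2_norm_eq_inner)
  obtain u where "norm u = 1" "eigenvector Irot u srot"
    using lambda_min_symmetric(1)[OF symrot] assms(15) by auto
  then have "is_minimum srot (effective_information I ` {\<phi>. norm \<phi> = 1})"
    using att[of u] bound1 by (auto simp: is_minimum_def)
  moreover have "least_informative_direction I \<phi>"
    if "norm \<phi> = 1" "eigenvector Irot \<phi> srot" for \<phi>
    using that att[of \<phi>] bound1
    by (auto simp: least_informative_direction_def is_arg_min_def not_less)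
  ultimately show ?thesis
    using att bound by blast
qed

end
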